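(* Let $n\geq1$. For $v,w\in\mathfrak{S}_n$ set \[\lambda(v,w)=\#\{\mathsf{S}\subseteq[n-1]\mid \mathrm{Des}(w^{-1}v_\mathsf{S})\subseteq\mathsf{S},\ \#\mathsf{S}\text{ odd}\}-\#\{\mathsf{S}\subseteq[n-1]\mid \mathrm{Des}(w^{-1}v_\mathsf{S})\subseteq\mathsf{S},\ \#\mathsf{S}\text{ even}\}.\] Then the antipode $S$ of $\mathfrak{S}\mathit{Sym}$ satisfies, for every $v\in\mathfrak{S}_n$, \[S(\mathcal{F}_v)=\sum_{w\in\mathfrak{S}_n}\lambda(v,w)\,\mathcal{F}_w.\]
   Context: $\mathfrak{S}_n$ is the symmetric group on $[n]$; $u$ is written as the word $u_1\cdots u_n$, $u_i=u(i)$; permutations multiply as functions, $(uv)(i)=u(v(i))$. $\mathrm{Des}(u)=\{p\in[n-1]\mid u_p>u_{p+1}\}$. For distinct integers $a_1,\dots,a_p$, $\mathrm{st}(a_1,\dots,a_p)\in\mathfrak{S}_p$ is the permutation $u$ with $u_i<u_j\iff a_i<a_j$. For $u\in\mathfrak{S}_p,v\in\mathfrak{S}_q$, $u\times v\in\mathfrak{S}_{p+q}$ has word $u_1\cdots u_p(v_1+p)\cdots(v_q+p)$. For $\mathsf{S}=\{p_1<\dots<p_k\}\subseteq[n-1]$ and $v\in\mathfrak{S}_n$, $v_\mathsf{S}=\mathrm{st}(v_1,\dots,v_{p_1})\times\mathrm{st}(v_{p_1+1},\dots,v_{p_2})\times\cdots\times\mathrm{st}(v_{p_k+1},\dots,v_n)\in\mathfrak{S}_n$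 (so $v_\emptyset=v$). $\mathfrak{S}^{(p,q)}$ is the set of $\zeta\in\mathfrak{S}_{p+q}$ having no descent except possibly at position $p$. $\mathfrak{S}\mathit{Sym}$ is the graded $\mathbb{Q}$-vector space with basis $\{\mathcal{F}_u\mid u\in\mathfrak{S}_n,n\geq0\}$, with product $\mathcal{F}_u\cdot\mathcal{F}_v=\sum_{\zeta\in\mathfrak{S}^{(p,q)}}\mathcal{F}_{(u\times v)\zeta^{-1}}$ for $u\in\mathfrak{S}_p,v\in\mathfrak{S}_q$, unit $\mathcal{F}_\emptyset$ (the empty permutation in $\mathfrak{S}_0$), coproduct $\Delta(\mathcal{F}_u)=\sum_{p=0}^n\mathcal{F}_{\mathrm{st}(u_1,\dots,u_p)}\otimes\mathcal{F}_{\mathrm{st}(u_{p+1},\dots,u_n)}$ and counit vanishing in positive degrees; it is a graded connected Hopf algebra (Malvenuto–Reutenauer), and $S$ denotes its antipode. *)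

theory Defs
  imports Complex_Main "HOL-Combinatorics.Permutations" "HOL-Library.Poly_Mapping"
begin

section \<open>Permutations\<close>

text \<open>
  An element of the symmetric group on \<open>{1..n}\<close> is a function \<open>u :: nat \<Rightarrow> nat\<close> with
  \<open>u permutes {1..n}\<close>; such a function fixes every number outside \<open>{1..n}\<close>.
  Products and inverses are the library's \<open>\<circ>\<close> and \<open>inv\<close>.
\<close>

definition Des :: "nat \<Rightarrow> (nat \<Rightarrow> nat) \<Rightarrow> nat set" where
  "Des n u = {p \<in> {1..n - 1}. u p > u (p + 1)}"

definition standardizes :: "nat list \<Rightarrow> (nat \<Rightarrow> nat) \<Rightarrow> bool" where
  "standardizes a u \<longleftrightarrow> u permutes {1..length a} \<and>
     (\<forall>i\<in>{1..length a}. \<forall>j\<in>{1..length a}. u i < u j \<longleftrightarrow> a ! (i - 1) < a ! (j - 1))"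

text \<open>Only used for lists of distinct numbers; see \<open>standardizes_ex1\<close> below.\<close>

definition st :: "nat list \<Rightarrow> nat \<Rightarrow> nat" where
  "st a = (THE u. standardizes a u)"

text \<open>The word \<open>u (a + 1), \<dots>, u b\<close>.\<close>

definition subword :: "(nat \<Rightarrow> nat) \<Rightarrow> nat \<Rightarrow> nat \<Rightarrow> nat list" where
  "subword u a b = map u [a + 1..<b + 1]"

text \<open>
  The product \<open>u \<times> v\<close> of a permutation \<open>u\<close> of \<open>{1..p}\<close> and a permutation \<open>v\<close> of \<open>{1..q}\<close>.
  The number \<open>q\<close> is not needed as an argument: since \<open>v\<close> fixes all \<open>i > q\<close>, the formula
  fixes all \<open>i > p + q\<close>.
\<close>

definition cross :: "nat \<Rightarrow> (nat \<Rightarrow> nat) \<Rightarrow> (nat \<Rightarrow> nat) \<Rightarrow> nat \<Rightarrow> nat" where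
  "cross p u v = (\<lambda>i. if i \<le> p then u i else v (i - p) + p)"

text \<open>
  The permutation \<open>v\<^sub>S\<close>: the list zipped below consists of the pairs of consecutive elements
  of \<open>0 < p\<^sub>1 < \<dots> < p\<^sub>k \<le> n\<close>, and \<open>id\<close> is the permutation of the empty set, the unit of \<open>\<times>\<close>.
\<close>

definition block_std :: "nat \<Rightarrow> (nat \<Rightarrow> nat) \<Rightarrow> nat set \<Rightarrow> nat \<Rightarrow> nat" where
  "block_std n v S =
     (let ps = sorted_list_of_set S in
      foldr (\<lambda>(a, b) w. cross (b - a) (st (subword v a b)) w) (zip (0 # ps) (ps @ [n])) id)"

text \<open>The set of permutations of \<open>{1..p + q}\<close> without descents except possibly at \<open>p\<close>.\<close>

definition grassmannian :: "nat \<Rightarrow> nat \<Rightarrow> (nat \<Rightarrow> nat) set" where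
  "grassmannian p q = {\<zeta>. \<zeta> permutes {1..p + q} \<and> Des (p + q) \<zeta> \<subseteq> {p}}"


subsection \<open>Well-definedness\<close>

lemma standardizes_ex1:
  assumes "distinct a"
  shows "\<exists>!u. standardizes a u"
proof -
  define n where "n = length a"
  define A where "A = {1..n}"
  define x where "x = (\<lambda>i. a ! (i - 1))"
  define u where "u = (\<lambda>i. if i \<in> A then card {j \<in> A. x j \<le> x i} else i)"
  have fin: "finite A" by (simp add: A_def)
  have x_inj: "x i \<noteq> x j" if "i \<in> A" "j \<in> A" "i \<noteq> j" for i j
    using that assms by (auto simp: A_def x_def n_def nth_eq_iff_index_eq)
  have less: "u i < u j" if "i \<in> A" "j \<in> A" "x i < x j" for i j
  proof -
    have "{k \<in> A. x k \<le> x i} \<subset> {k \<in> A. x k \<le> x j}"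
      using that by force
    then show ?thesis
      using that fin by (simp add: u_def psubset_card_mono)
  qed
  have iff: "u i < u j \<longleftrightarrow> x i < x j" if "i \<in> A" "j \<in> A" for i j
    using less[OF that] less[OF that(2) that(1)] x_inj[OF that]
    by (metis less_asym less_irrefl linorder_neqE_nat)
  have "u ` A \<subseteq> A"
  proof
    fix k assume "k \<in> u ` A"
    then obtain i where i: "i \<in> A" "k = card {j \<in> A. x j \<le> x i}" by (auto simp: u_def)
    have "card {i} \<le> k" unfolding i(2) by (rule card_mono) (use fin i in auto)
    moreover have "k \<le> card A" unfolding i(2) by (rule card_mono) (use fin in auto)
    ultimately show "k \<in> A" by (simp add: A_def)
  qed
  moreover have "inj_on u A"
  proof (rule inj_onI)
    fix i j assume ij: "i \<in> A" "j \<in> A" "u i = u j"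
    then show "i = j"
      using iff[OF ij(1,2)] iff[OF ij(2,1)] x_inj[OF ij(1,2)] by auto
  qed
  ultimately have "bij_betw u A A"
    using fin by (simp add: bij_betw_def endo_inj_surj)
  then have "u permutes A"
    by (rule bij_imp_permutes) (simp add: u_def)
  then have "standardizes a u"
    using iff by (simp add: standardizes_def A_def n_def x_def)
  moreover have "w = u" if "standardizes a w" for w
  proof
    fix i
    from that have w: "w permutes A" and w_iff: "\<And>i j. i \<in> A \<Longrightarrow> j \<in> A \<Longrightarrow> w i < w j \<longleftrightarrow> x i < x j"
      by (auto simp: standardizes_def A_def n_def x_def)
    show "w i = u i"
    proof (cases "i \<in> A")
      case True
      have "{j \<in> A. x j \<le> x i} = {j \<in> A. w j \<le> w i}"
        using w_iff[OF True] by (auto simp: not_less[symmetric])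
      then have "u i = card {j \<in> A. w j \<le> w i}"
        using True by (simp add: u_def)
      also have "\<dots> = card (w ` {j \<in> A. w j \<le> w i})"
        by (rule card_image[symmetric]) (rule inj_on_subset[OF permutes_inj[OF w]], simp)
      also have "w ` {j \<in> A. w j \<le> w i} = {k \<in> A. k \<le> w i}"
      proof (intro equalityI subsetI)
        fix k assume "k \<in> {k \<in> A. k \<le> w i}"
        moreover from this obtain j where "j \<in> A" "k = w j"
          using permutes_image[OF w] by (metis (no_types, lifting) imageE mem_Collect_eq)
        ultimately show "k \<in> w ` {j \<in> A. w j \<le> w i}" by simp
      next
        fix k assume "k \<in> w ` {j \<in> A. w j \<le> w i}"
        then obtain j where "j \<in> A" "w j \<le> w i" "k = w j" by (elim imageE) auto
        then show "k \<in> {k \<in> A. k \<le> w i}"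
          using permutes_in_image[OF w, of j] by simp
      qed
      also have "\<dots> = {1..w i}"
        using permutes_in_image[OF w, of i] True unfolding A_def by auto
      finally show ?thesis by simp
    next
      case False
      then show ?thesis using permutes_not_in[OF w] by (simp add: u_def)
    qed
  qed
  ultimately show ?thesis by blast
qed

lemma st_standardizes: "distinct a \<Longrightarrow> standardizes a (st a)"
  unfolding st_def by (erule theI'[OF standardizes_ex1])

lemma cross_permutes:
  assumes u: "u permutes {1..p}" and v: "v permutes {1..q}"
  shows "cross p u v permutes {1..p + q}"
proof (rule bij_imp_permutes)
  have inj: "inj_on (cross p u v) {1..p + q}"
  proof (rule inj_onI)
    fix i j assume ij: "i \<in> {1..p + q}" "j \<in> {1..p + q}" "cross p u v i = cross p u v j"
    have le: "u k \<le> p" if "k \<in> {1..p + q}" "k \<le> p" for k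
      using permutes_in_image[OF u, of k] that by auto
    have gr: "0 < v (k - p)" if "k \<in> {1..p + q}" "\<not> k \<le> p" for k
      using permutes_in_image[OF v, of "k - p"] that by auto
    have ui: "u i = u j \<longleftrightarrow> i = j"
      using permutes_inj[OF u] by (simp add: inj_eq)
    have vi: "v (i - p) = v (j - p) \<longleftrightarrow> i - p = j - p"
      using permutes_inj[OF v] by (simp add: inj_eq)
    consider "i \<le> p" "j \<le> p" | "\<not> i \<le> p" "\<not> j \<le> p" | "i \<le> p" "\<not> j \<le> p" | "\<not> i \<le> p" "j \<le> p"
      by blast
    then show "i = j"
    proof cases
      case 1
      with ij(3) ui show ?thesis by (simp add: cross_def)
    next
      case 2
      with ij(3) vi have "i - p = j - p" by (simp add: cross_def)
      with 2 show ?thesis by linarith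
    next
      case 3
      with ij(3) le[OF ij(1)] gr[OF ij(2)] show ?thesis by (simp add: cross_def)
    next
      case 4
      with ij(3) le[OF ij(2)] gr[OF ij(1)] show ?thesis by (simp add: cross_def)
    qed
  qed
  have "cross p u v ` {1..p + q} \<subseteq> {1..p + q}"
  proof
    fix k assume "k \<in> cross p u v ` {1..p + q}"
    then obtain i where i: "i \<in> {1..p + q}" "k = cross p u v i" by auto
    show "k \<in> {1..p + q}"
      using permutes_in_image[OF u, of i] permutes_in_image[OF v, of "i - p"] i
      by (auto simp: cross_def split: if_splits)
  qed
  with inj show "bij_betw (cross p u v) {1..p + q} {1..p + q}"
    by (simp add: bij_betw_def endo_inj_surj)
  show "cross p u v i = i" if "i \<notin> {1..p + q}" for i
  proof (cases "i \<le> p")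
    case True
    with that permutes_not_in[OF u, of i] show ?thesis by (simp add: cross_def)
  next
    case False
    with that have "i - p \<notin> {1..q}" by auto
    with False permutes_not_in[OF v] show ?thesis by (simp add: cross_def)
  qed
qed


section \<open>The Malvenuto--Reutenauer Hopf algebra\<close>

text \<open>
  Basis elements are indexed by pairs \<open>(n, u)\<close>, because the identity function, say, represents
  a permutation in every degree.
\<close>

typedef graded_perm = "{(n, u). u permutes {1..n}} :: (nat \<times> (nat \<Rightarrow> nat)) set"
  by (auto intro: permutes_id)

type_synonym ssym = "graded_perm \<Rightarrow>\<^sub>0 rat"

text \<open>The tensor square of \<open>ssym\<close>, through its basis of pairs.\<close>

type_synonym ssym2 = "graded_perm \<times> graded_perm \<Rightarrow>\<^sub>0 rat"

definition scale :: "rat \<Rightarrow> ('b \<Rightarrow>\<^sub>0 rat) \<Rightarrow> ('b \<Rightarrow>\<^sub>0 rat)" where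
  "scale c x = Poly_Mapping.map ((*) c) x"

lemma lookup_scale: "Poly_Mapping.lookup (scale c x) b = c * Poly_Mapping.lookup x b"
  by (simp add: scale_def Poly_Mapping.map.rep_eq when_def)

lemma vector_space_scale: "vector_space (scale :: rat \<Rightarrow> ('b \<Rightarrow>\<^sub>0 rat) \<Rightarrow> ('b \<Rightarrow>\<^sub>0 rat))"
  by unfold_locales (auto intro!: poly_mapping_eqI simp: lookup_scale lookup_add algebra_simps)

text \<open>The linear map taking each basis element \<open>b\<close> to \<open>f b\<close>.\<close>

definition lin_ext :: "('b \<Rightarrow> ('c \<Rightarrow>\<^sub>0 rat)) \<Rightarrow> ('b \<Rightarrow>\<^sub>0 rat) \<Rightarrow> ('c \<Rightarrow>\<^sub>0 rat)" where
  "lin_ext f x = (\<Sum>b\<in>Poly_Mapping.keys x. scale (Poly_Mapping.lookup x b) (f b))"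

text \<open>The basis element indexed by the permutation \<open>u\<close> of \<open>{1..n}\<close>.\<close>

definition F :: "nat \<Rightarrow> (nat \<Rightarrow> nat) \<Rightarrow> ssym" where
  "F n u = Poly_Mapping.single (Abs_graded_perm (n, u)) 1"

definition tensor :: "ssym \<Rightarrow> ssym \<Rightarrow> ssym2" where
  "tensor x y = (\<Sum>a\<in>Poly_Mapping.keys x. \<Sum>b\<in>Poly_Mapping.keys y.
     Poly_Mapping.single (a, b) (Poly_Mapping.lookup x a * Poly_Mapping.lookup y b))"

text \<open>The tensor product of two linear maps.\<close>

definition tensor_map :: "(ssym \<Rightarrow> ssym) \<Rightarrow> (ssym \<Rightarrow> ssym) \<Rightarrow> ssym2 \<Rightarrow> ssym2" where
  "tensor_map f g =
     lin_ext (\<lambda>(a, b). tensor (f (Poly_Mapping.single a 1)) (g (Poly_Mapping.single b 1)))"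

definition ssym_mult :: "ssym2 \<Rightarrow> ssym" where
  "ssym_mult = lin_ext (\<lambda>(a, b). case (Rep_graded_perm a, Rep_graded_perm b) of
     ((p, u), (q, v)) \<Rightarrow> (\<Sum>\<zeta>\<in>grassmannian p q. F (p + q) (cross p u v \<circ> inv \<zeta>)))"

definition ssym_unit :: "rat \<Rightarrow> ssym" where
  "ssym_unit c = scale c (F 0 id)"

definition ssym_comult :: "ssym \<Rightarrow> ssym2" where
  "ssym_comult = lin_ext (\<lambda>a. case Rep_graded_perm a of (n, u) \<Rightarrow>
     (\<Sum>p = 0..n. tensor (F p (st (subword u 0 p))) (F (n - p) (st (subword u p n)))))"

definition ssym_counit :: "ssym \<Rightarrow> rat" where
  "ssym_counit x = Poly_Mapping.lookup x (Abs_graded_perm (0, id))"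

definition convolution :: "(ssym \<Rightarrow> ssym) \<Rightarrow> (ssym \<Rightarrow> ssym) \<Rightarrow> ssym \<Rightarrow> ssym" where
  "convolution f g = ssym_mult \<circ> tensor_map f g \<circ> ssym_comult"

definition is_antipode :: "(ssym \<Rightarrow> ssym) \<Rightarrow> bool" where
  "is_antipode S \<longleftrightarrow> Vector_Spaces.linear scale scale S \<and>
     convolution S id = ssym_unit \<circ> ssym_counit \<and>
     convolution id S = ssym_unit \<circ> ssym_counit"

definition antipode :: "ssym \<Rightarrow> ssym" where
  "antipode = (THE S. is_antipode S)"


section \<open>The coefficients\<close>

definition lam :: "nat \<Rightarrow> (nat \<Rightarrow> nat) \<Rightarrow> (nat \<Rightarrow> nat) \<Rightarrow> int" where
  "lam n v w =
     int (card {S. S \<subseteq> {1..n - 1} \<and> Des n (inv w \<circ> block_std n v S) \<subseteq> S \<and> odd (card S)}) -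
     int (card {S. S \<subseteq> {1..n - 1} \<and> Des n (inv w \<circ> block_std n v S) \<subseteq> S \<and> even (card S)})"

end

theory Submission
  imports Defs
begin

text \<open>
  Write \<open>E\<^sub>S(u)\<close> for the sum of \<open>F (u \<zeta>\<^sup>-\<^sup>1)\<close> over all \<open>\<zeta>\<close> with \<open>Des \<zeta> \<subseteq> S\<close> (\<open>coarsened\<close> below).
  Factoring a permutation through a Young subgroup gives
  \<open>E\<^sub>S(u) E\<^sub>T(v) = E\<^sub>R(u \<times> v)\<close> with \<open>R = S \<union> {p} \<union> (T + p)\<close>, where \<open>p\<close> is the degree of \<open>u\<close>.
  The claimed value at \<open>F v\<close> is the alternating sum of all \<open>- (-1)\<^bsup>|S|\<^esup> E\<^sub>S(v\<^sub>S)\<close>.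
  Convolving it with the identity, the term of the coproduct that cuts \<open>v\<close> at \<open>p\<close> equals minus the
  sum of those summands with \<open>Max S = p\<close> (or, on the other side, \<open>Min S = p\<close>), and the two extreme
  terms supply the summand \<open>S = {}\<close> and the full sum, so everything cancels.
  Neither associativity nor coassociativity is needed: a left convolution inverse of the identity
  is unique because the convolution equation determines it recursively by degree.
\<close>


section \<open>Linear algebra over the basis\<close>

text \<open>Coefficients off the support are zero, so any finite superset may serve as index set;
  two arguments with different supports can then share one.\<close>

lemma lin_ext_sum:
  assumes "finite A" "Poly_Mapping.keys x \<subseteq> A"
  shows "lin_ext f x = (\<Sum>b\<in>A. scale (Poly_Mapping.lookup x b) (f b))"
  unfolding lin_ext_def
  by (rule sum.mono_neutral_left)
    (use assms in \<open>auto simp: in_keys_iff intro!: poly_mapping_eqI simp: lookup_scale\<close>)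

lemma linear_iff_scale:
  "Vector_Spaces.linear scale scale f \<longleftrightarrow>
     (\<forall>x y. f (x + y) = f x + f y) \<and> (\<forall>c x. f (scale c x) = scale c (f x))"
  by (auto simp: Vector_Spaces.linear_iff vector_space_scale)

lemma lin_ext_linear: "Vector_Spaces.linear scale scale (lin_ext f)"
proof -
  have "lin_ext f (x + y) = lin_ext f x + lin_ext f y" for x y
  proof -
    let ?A = "Poly_Mapping.keys x \<union> Poly_Mapping.keys y"
    have "Poly_Mapping.keys (x + y) \<subseteq> ?A" by (rule keys_add)
    then show ?thesis
      by (simp add: lin_ext_sum[of ?A] sum.distrib[symmetric] lookup_add
          vector_space.vector_space_assms(2)[OF vector_space_scale])
  qed
  moreover have "lin_ext f (scale c x) = scale c (lin_ext f x)" for c x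
  proof -
    have "Poly_Mapping.keys (scale c x) \<subseteq> Poly_Mapping.keys x"
      by (auto simp: in_keys_iff lookup_scale)
    then show ?thesis
      by (auto simp: lin_ext_sum[of "Poly_Mapping.keys x"] lookup_scale lookup_sum
          sum_distrib_left mult.assoc intro!: poly_mapping_eqI)
  qed
  ultimately show ?thesis by (simp add: linear_iff_scale)
qed

lemma scale_one: "scale 1 x = x"
  by (auto intro!: poly_mapping_eqI simp: lookup_scale)

lemma scale_zero: "scale 0 x = 0"
  by (auto intro!: poly_mapping_eqI simp: lookup_scale)

lemma scale_sum_right: "scale c (sum g A) = (\<Sum>a\<in>A. scale c (g a))"
  by (auto intro!: poly_mapping_eqI simp: lookup_scale lookup_sum sum_distrib_left)

lemma scale_sum_left: "scale (sum g A) x = (\<Sum>a\<in>A. scale (g a) x)"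
  by (auto intro!: poly_mapping_eqI simp: lookup_scale lookup_sum sum_distrib_right)

lemma scale_minus_left: "scale (- c) x = - scale c x"
  by (auto intro!: poly_mapping_eqI simp: lookup_scale)

lemma lin_ext_single: "lin_ext f (Poly_Mapping.single b 1) = f b"
  by (simp add: lin_ext_def scale_one)

lemma linear_eq_on_basis:
  assumes f: "Vector_Spaces.linear scale scale f" and g: "Vector_Spaces.linear scale scale g"
    and eq: "\<And>b. f (Poly_Mapping.single b 1) = g (Poly_Mapping.single b 1)"
  shows "f = g"
proof
  fix x :: "'a \<Rightarrow>\<^sub>0 rat"
  interpret f: Vector_Spaces.linear scale scale f by fact
  interpret g: Vector_Spaces.linear scale scale g by fact
  have "x = (\<Sum>b\<in>Poly_Mapping.keys x. scale (Poly_Mapping.lookup x b) (Poly_Mapping.single b 1))"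
    by (rule poly_mapping_eqI)
      (simp add: lookup_sum lookup_scale lookup_single when_def sum.If_cases if_distrib in_keys_iff
        sum.delta' cong: if_cong)
  then show "f x = g x"
    by (metis (no_types, lifting) f.scale f.sum g.scale g.sum eq sum.cong)
qed

lemma lookup_tensor:
  "Poly_Mapping.lookup (tensor x y) (a, b) = Poly_Mapping.lookup x a * Poly_Mapping.lookup y b"
proof -
  have "Poly_Mapping.lookup (tensor x y) (a, b) =
     (\<Sum>a'\<in>Poly_Mapping.keys x. if a' = a then \<Sum>b'\<in>Poly_Mapping.keys y.
        if b' = b then Poly_Mapping.lookup x a' * Poly_Mapping.lookup y b' else 0 else 0)"
    unfolding tensor_def lookup_sum lookup_single by (rule sum.cong) (auto simp: when_def)
  also have "\<dots> = Poly_Mapping.lookup x a * Poly_Mapping.lookup y b"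
    by (simp add: in_keys_iff)
  finally show ?thesis .
qed

lemma tensor_single:
  "tensor (Poly_Mapping.single a 1) (Poly_Mapping.single b 1) = Poly_Mapping.single (a, b) 1"
  by (simp add: tensor_def)

lemma tensor_linear_left: "Vector_Spaces.linear scale scale (\<lambda>x. tensor x y)"
  unfolding linear_iff_scale
  by (auto intro!: poly_mapping_eqI simp: lookup_tensor lookup_add lookup_scale algebra_simps)

lemma tensor_linear_right: "Vector_Spaces.linear scale scale (tensor x)"
  unfolding linear_iff_scale
  by (auto intro!: poly_mapping_eqI simp: lookup_tensor lookup_add lookup_scale algebra_simps)

section \<open>The bilinear product, and convolution on basis elements\<close>

definition ssym_prod :: "ssym \<Rightarrow> ssym \<Rightarrow> ssym" (infixl "\<odot>" 70) where
  "x \<odot> y = ssym_mult (tensor x y)"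

lemma linear_comp:
  assumes "Vector_Spaces.linear scale scale f" "Vector_Spaces.linear scale scale g"
  shows "Vector_Spaces.linear scale scale (g \<circ> f)"
  using assms by (simp add: linear_iff_scale)

lemma ssym_prod_linear_left: "Vector_Spaces.linear scale scale (\<lambda>x. x \<odot> y)"
  using linear_comp[OF tensor_linear_left lin_ext_linear]
  by (simp add: ssym_prod_def ssym_mult_def o_def)

lemma ssym_prod_linear_right: "Vector_Spaces.linear scale scale (ssym_prod x)"
proof -
  have "ssym_prod x = ssym_mult \<circ> tensor x"
    by (simp add: ssym_prod_def fun_eq_iff)
  then show ?thesis
    by (simp only: ssym_mult_def linear_comp[OF tensor_linear_right lin_ext_linear])
qed

lemma ssym_prod_sum_left: "sum g A \<odot> y = (\<Sum>a\<in>A. g a \<odot> y)"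
  by (rule module_hom.sum[OF Vector_Spaces.linear.axioms(3)[OF ssym_prod_linear_left]])

lemma ssym_prod_sum_right: "x \<odot> sum g A = (\<Sum>a\<in>A. x \<odot> g a)"
  by (rule module_hom.sum[OF Vector_Spaces.linear.axioms(3)[OF ssym_prod_linear_right]])

lemma ssym_prod_scale_left: "scale c x \<odot> y = scale c (x \<odot> y)"
  using ssym_prod_linear_left by (simp add: linear_iff_scale)

lemma ssym_prod_scale_right: "x \<odot> scale c y = scale c (x \<odot> y)"
  using ssym_prod_linear_right by (simp add: linear_iff_scale)

lemma Rep_Abs_graded_perm: "u permutes {1..n} \<Longrightarrow> Rep_graded_perm (Abs_graded_perm (n, u)) = (n, u)"
  by (simp add: Abs_graded_perm_inverse)

lemma ssym_prod_F:
  assumes "u permutes {1..p}" "v permutes {1..q}"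
  shows "F p u \<odot> F q v = (\<Sum>\<zeta>\<in>grassmannian p q. F (p + q) (cross p u v \<circ> inv \<zeta>))"
  using assms by (simp add: ssym_prod_def F_def tensor_single ssym_mult_def lin_ext_single Rep_Abs_graded_perm)

lemma convolution_linear: "Vector_Spaces.linear scale scale (convolution f g)"
  unfolding convolution_def tensor_map_def ssym_mult_def ssym_comult_def
  by (intro linear_comp lin_ext_linear)

text \<open>Each cut of the word gives a pure tensor of basis elements, on which
  \<open>tensor_map\<close> followed by multiplication is the product of the two images; linearity
  handles the sum over cuts.\<close>

lemma convolution_F:
  assumes "u permutes {1..n}"
  shows "convolution f g (F n u) =
    (\<Sum>p = 0..n. f (F p (st (subword u 0 p))) \<odot> g (F (n - p) (st (subword u p n))))"
proof -
  have 1: "ssym_mult (tensor_map f g (tensor (F p u) (F q v))) = f (F p u) \<odot> g (F q v)" for p u q v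
    by (simp add: F_def tensor_single tensor_map_def lin_ext_single ssym_prod_def)
  have "Vector_Spaces.linear scale scale (ssym_mult \<circ> tensor_map f g)"
    unfolding tensor_map_def ssym_mult_def by (intro linear_comp lin_ext_linear)
  note 2 = module_hom.sum[OF Vector_Spaces.linear.axioms(3)[OF this], unfolded o_apply]
  show ?thesis
    using assms
    by (simp add: 1 2 convolution_def ssym_comult_def lin_ext_single Rep_Abs_graded_perm F_def[of n])
qed

lemma linear_eq_on_F:
  assumes f: "Vector_Spaces.linear scale scale f" and g: "Vector_Spaces.linear scale scale g"
    and eq: "\<And>n u. u permutes {1..n} \<Longrightarrow> f (F n u) = g (F n u)"
  shows "f = g"
proof (rule linear_eq_on_basis[OF f g])
  fix b
  obtain n u where "b = Abs_graded_perm (n, u)" "u permutes {1..n}"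
    by (cases b) auto
  then show "f (Poly_Mapping.single b 1) = g (Poly_Mapping.single b 1)"
    using eq[of u n] by (simp add: F_def)
qed

lemma unit_counit_linear: "Vector_Spaces.linear scale scale (ssym_unit \<circ> ssym_counit)"
  unfolding linear_iff_scale ssym_unit_def ssym_counit_def
  by (auto intro!: poly_mapping_eqI simp: lookup_scale lookup_add algebra_simps)

lemma unit_counit_F:
  assumes "u permutes {1..n}"
  shows "(ssym_unit \<circ> ssym_counit) (F n u) = (if n = 0 then F 0 id else 0)"
proof -
  \<comment> \<open>\<open>{1..0}\<close> is empty, so in degree 0 the identity is the only
    permutation.\<close>
  have "Abs_graded_perm (n, u) = Abs_graded_perm (0, id) \<longleftrightarrow> n = 0"
    using assms by (subst Abs_graded_perm_inject) (auto simp: permutes_id)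
  then show ?thesis
    by (auto simp: ssym_unit_def ssym_counit_def F_def lookup_single scale_one scale_zero)
qed


section \<open>Standardization and descents\<close>

lemma strict_mono_of_adjacent:
  fixes z :: "nat \<Rightarrow> nat"
  assumes "\<And>k. a \<le> k \<Longrightarrow> k < b \<Longrightarrow> z k < z (Suc k)" "a \<le> i" "i < j" "j \<le> b"
  shows "z i < z j"
  using \<open>i < j\<close> \<open>j \<le> b\<close>
proof (induction j)
  case (Suc j)
  then show ?case
    using assms(1)[of j] assms(2) by (cases "i = j") auto
qed simp

lemma increasing_permutes_eq_id:
  fixes z :: "nat \<Rightarrow> nat"
  assumes z: "z permutes {1..n}" and inc: "\<And>k. 1 \<le> k \<Longrightarrow> k < n \<Longrightarrow> z k < z (Suc k)"
  shows "z = id"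
proof (rule permutes_natset_ge[OF z])
  \<comment> \<open>Strictly increasing positive integers satisfy \<open>i \<le> z i\<close>, and a
    permutation of an initial interval with this property is the identity.\<close>
  have "1 \<le> i \<longrightarrow> i \<le> n \<longrightarrow> i \<le> z i" for i
  proof (induction i)
    case (Suc i)
    show ?case
    proof (cases "i = 0")
      case True
      then show ?thesis
        using permutes_in_image[OF z, of "Suc i"] by auto
    next
      case False
      with Suc inc[of i] show ?thesis by auto
    qed
  qed simp
  then show "\<forall>i\<in>{1..n}. i \<le> z i" by simp
qed

text \<open>For \<open>S \<subseteq> {1..n - 1}\<close> these are the minimal-length representatives
  of the left cosets of the Young subgroup whose blocks are cut at \<open>S\<close>.\<close>

definition des_perms :: "nat \<Rightarrow> nat set \<Rightarrow> (nat \<Rightarrow> nat) set" where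
  "des_perms n S = {\<zeta>. \<zeta> permutes {1..n} \<and> Des n \<zeta> \<subseteq> S}"

lemma grassmannian_eq_des_perms: "grassmannian p q = des_perms (p + q) {p}"
  by (simp add: grassmannian_def des_perms_def)

lemma mem_des_perms_iff:
  "\<zeta> \<in> des_perms n S \<longleftrightarrow>
     \<zeta> permutes {1..n} \<and> (\<forall>k. 1 \<le> k \<longrightarrow> k < n \<longrightarrow> k \<notin> S \<longrightarrow> \<zeta> k < \<zeta> (Suc k))"
proof (cases "\<zeta> permutes {1..n}")
  case True
  have ne: "\<zeta> k \<noteq> \<zeta> (Suc k)" for k
    using permutes_inj[OF True] by (simp add: inj_eq)
  have "Des n \<zeta> \<subseteq> S \<longleftrightarrow> (\<forall>k. 1 \<le> k \<longrightarrow> k < n \<longrightarrow> k \<notin> S \<longrightarrow> \<not> \<zeta> k > \<zeta> (Suc k))"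
    by (auto simp: Des_def)
  also have "\<dots> \<longleftrightarrow> (\<forall>k. 1 \<le> k \<longrightarrow> k < n \<longrightarrow> k \<notin> S \<longrightarrow> \<zeta> k < \<zeta> (Suc k))"
    using ne by (metis linorder_neqE_nat not_less_iff_gr_or_eq)
  finally show ?thesis
    using True by (simp add: des_perms_def)
qed (simp add: des_perms_def)

text \<open>Descents lie in \<open>{1..n - 1}\<close>; this discards the cuts at \<open>0\<close> or
  \<open>n\<close> that arise in products with a factor of degree 0.\<close>

lemma des_perms_Int: "des_perms n S = des_perms n (S \<inter> {1..n - 1})"
  by (auto simp: mem_des_perms_iff)

lemma des_perms_empty: "des_perms n {} = {id}"
  by (auto simp: mem_des_perms_iff permutes_id intro: increasing_permutes_eq_id)

section \<open>Standardization of subwords\<close>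

lemma length_subword: "length (subword u a b) = b - a"
  by (simp add: subword_def del: upt_Suc)

lemma nth_subword: "i < b - a \<Longrightarrow> subword u a b ! i = u (a + 1 + i)"
  by (simp add: subword_def del: upt_Suc)

lemma standardizes_subword:
  "standardizes (subword u a b) w \<longleftrightarrow> w permutes {1..b - a} \<and>
     (\<forall>i\<in>{1..b - a}. \<forall>j\<in>{1..b - a}. w i < w j \<longleftrightarrow> u (a + i) < u (a + j))"
  unfolding standardizes_def length_subword
  by (intro conj_cong refl ball_cong) (auto simp: nth_subword)

lemma distinct_subword: "inj u \<Longrightarrow> distinct (subword u a b)"
  by (auto simp: subword_def distinct_map intro: inj_on_subset)

lemma st_subword:
  assumes "inj u"
  shows "st (subword u a b) permutes {1..b - a}"
    and "i \<in> {1..b - a} \<Longrightarrow> j \<in> {1..b - a} \<Longrightarrow>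
      st (subword u a b) i < st (subword u a b) j \<longleftrightarrow> u (a + i) < u (a + j)"
  using st_standardizes[OF distinct_subword[OF assms], of a b] by (simp_all add: standardizes_subword)

lemma st_subword_eqI:
  assumes "inj u" "w permutes {1..b - a}"
    "\<And>i j. i \<in> {1..b - a} \<Longrightarrow> j \<in> {1..b - a} \<Longrightarrow> w i < w j \<longleftrightarrow> u (a + i) < u (a + j)"
  shows "st (subword u a b) = w"
proof -
  have "standardizes (subword u a b) w"
    using assms by (simp add: standardizes_subword)
  then show ?thesis
    using standardizes_ex1[OF distinct_subword[OF assms(1), of a b]]
      st_standardizes[OF distinct_subword[OF assms(1), of a b]] by blast
qed

lemma st_subword_whole:
  assumes "u permutes {1..n}"
  shows "st (subword u 0 n) = u"
  by (rule st_subword_eqI) (use assms permutes_inj[OF assms] in auto)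

text \<open>Standardizing keeps the relative order inside the window, so both words are standardized
  by the same permutations.\<close>

lemma st_subword_st_subword:
  assumes "inj u" "d \<le> b - a"
  shows "st (subword (st (subword u a b)) c d) = st (subword u (a + c) (a + d))"
proof -
  have "standardizes (subword (st (subword u a b)) c d) = standardizes (subword u (a + c) (a + d))"
    using st_subword(2)[OF assms(1), of _ b a] assms(2)
    by (auto simp: fun_eq_iff standardizes_subword add.assoc)
  then show ?thesis by (simp add: st_def)
qed

section \<open>Block products of permutations\<close>

lemma cross_assoc: "cross (p + q) (cross p u v) w = cross p u (cross q v w)"
  by (auto simp: cross_def fun_eq_iff)

lemma cross_left: "i \<le> p \<Longrightarrow> cross p u v i = u i"
  by (simp add: cross_def)

lemma cross_right: "1 \<le> i \<Longrightarrow> cross p u v (p + i) = p + v i"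
  by (simp add: cross_def)

lemma cross_id:
  assumes "u permutes {1..p}"
  shows "cross p u id = u"
  using permutes_not_in[OF assms] by (auto simp: cross_def fun_eq_iff)

lemma permutes_le_iff:
  fixes p :: nat
  assumes "u permutes {1..p}"
  shows "u i \<le> p \<longleftrightarrow> i \<le> p"
  using permutes_in_image[OF assms, of i] permutes_not_in[OF assms, of i]
  by (cases "i \<in> {1..p}") auto

lemma permutes_eq_0_iff:
  assumes "u permutes {1..p}"
  shows "u i = 0 \<longleftrightarrow> i = (0::nat)"
  using permutes_in_image[OF assms, of i] permutes_not_in[OF assms, of i]
  by (cases "i \<in> {1..p}") auto

text \<open>The inner factor must keep the two blocks apart: \<open>u'\<close> preserves the bound
  \<open>p\<close>, and \<open>v'\<close> takes no positive argument to \<open>0\<close>, so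
  positions beyond \<open>p\<close> stay beyond it.\<close>

lemma cross_comp:
  assumes "u' permutes {1..p}" "v' permutes {1..q}"
  shows "cross p u v \<circ> cross p u' v' = cross p (u \<circ> u') (v \<circ> v')"
  by (auto simp: cross_def fun_eq_iff permutes_le_iff[OF assms(1)] permutes_eq_0_iff[OF assms(2)])

lemma inv_cross:
  assumes "u permutes {1..p}" "v permutes {1..q}"
  shows "inv (cross p u v) = cross p (inv u) (inv v)"
proof -
  have id: "cross p id id = id"
    by (auto simp: cross_def)
  have "cross p u v \<circ> cross p (inv u) (inv v) = id"
    by (simp add: cross_comp[OF permutes_inv[OF assms(1)] permutes_inv[OF assms(2)]]
        permutes_inv_o[OF assms(1)] permutes_inv_o[OF assms(2)] id)
  moreover have "cross p (inv u) (inv v) \<circ> cross p u v = id"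
    by (simp add: cross_comp[OF assms] permutes_inv_o[OF assms(1)] permutes_inv_o[OF assms(2)] id)
  ultimately show ?thesis by (rule inv_unique_comp)
qed

section \<open>Factorization through a Young subgroup with two blocks\<close>

lemma grassmannian_less_iff:
  assumes "\<xi> \<in> grassmannian p q"
  shows "i \<in> {1..p} \<Longrightarrow> j \<in> {1..p} \<Longrightarrow> \<xi> i < \<xi> j \<longleftrightarrow> i < j"
    and "i \<in> {1..q} \<Longrightarrow> j \<in> {1..q} \<Longrightarrow> \<xi> (p + i) < \<xi> (p + j) \<longleftrightarrow> i < j"
proof -
  have asc: "\<And>k. 1 \<le> k \<Longrightarrow> k < p + q \<Longrightarrow> k \<noteq> p \<Longrightarrow> \<xi> k < \<xi> (Suc k)"
    using assms by (simp add: grassmannian_eq_des_perms mem_des_perms_iff)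
  \<comment> \<open>The only possible descent is at \<open>p\<close>, so adjacent increases chain up
    inside each block.\<close>
  have 1: "\<xi> i < \<xi> j" if "1 \<le> i" "i < j" "j \<le> p" for i j
    by (rule strict_mono_of_adjacent[of 1 p]) (use that asc in auto)
  have 2: "\<xi> i < \<xi> j" if "p + 1 \<le> i" "i < j" "j \<le> p + q" for i j
    by (rule strict_mono_of_adjacent[of "p + 1" "p + q"]) (use that asc in auto)
  show "i \<in> {1..p} \<Longrightarrow> j \<in> {1..p} \<Longrightarrow> \<xi> i < \<xi> j \<longleftrightarrow> i < j"
    using 1[of i j] 1[of j i] by (cases i j rule: linorder_cases) auto
  show "i \<in> {1..q} \<Longrightarrow> j \<in> {1..q} \<Longrightarrow> \<xi> (p + i) < \<xi> (p + j) \<longleftrightarrow> i < j"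
    using 2[of "p + i" "p + j"] 2[of "p + j" "p + i"] by (cases i j rule: linorder_cases) auto
qed

text \<open>\<open>cross p u v\<close> maps each block to itself and \<open>\<xi>\<close> is
  increasing on it, so the composite has the relative order of \<open>u\<close> on the first block
  and of \<open>v\<close> on the second. Hence standardization recovers \<open>u\<close> and
  \<open>v\<close>.\<close>

lemma factor_less_iff:
  assumes "\<xi> \<in> grassmannian p q" "u permutes {1..p}" "v permutes {1..q}"
  shows "i \<in> {1..p} \<Longrightarrow> j \<in> {1..p} \<Longrightarrow>
      (\<xi> \<circ> cross p u v) i < (\<xi> \<circ> cross p u v) j \<longleftrightarrow> u i < u j"
    and "i \<in> {1..q} \<Longrightarrow> j \<in> {1..q} \<Longrightarrow>
      (\<xi> \<circ> cross p u v) (p + i) < (\<xi> \<circ> cross p u v) (p + j) \<longleftrightarrow> v i < v j"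
proof -
  assume *: "i \<in> {1..p}" "j \<in> {1..p}"
  then have "u i \<in> {1..p}" "u j \<in> {1..p}"
    by (simp_all only: permutes_in_image[OF assms(2)])
  with * show "(\<xi> \<circ> cross p u v) i < (\<xi> \<circ> cross p u v) j \<longleftrightarrow> u i < u j"
    using grassmannian_less_iff(1)[OF assms(1), of "u i" "u j"] by (auto simp: cross_left)
next
  assume *: "i \<in> {1..q}" "j \<in> {1..q}"
  then have "v i \<in> {1..q}" "v j \<in> {1..q}"
    by (simp_all only: permutes_in_image[OF assms(3)])
  with * show
    "(\<xi> \<circ> cross p u v) (p + i) < (\<xi> \<circ> cross p u v) (p + j) \<longleftrightarrow> v i < v j"
    using grassmannian_less_iff(2)[OF assms(1), of "v i" "v j"]
    by (simp add: cross_right)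
qed

text \<open>By the comparison on blocks, descents before \<open>p\<close> are those of
  \<open>u\<close> and descents after \<open>p\<close> are those of \<open>v\<close> shifted by
  \<open>p\<close>; position \<open>p\<close> itself is allowed and imposes nothing.\<close>

lemma factor_mem_iff:
  assumes S: "S \<subseteq> {1..p - 1}"
    and \<xi>: "\<xi> \<in> grassmannian p q" and u: "u permutes {1..p}" and v: "v permutes {1..q}"
  shows "\<xi> \<circ> cross p u v \<in> des_perms (p + q) (insert p (S \<union> (+) p ` S')) \<longleftrightarrow>
    u \<in> des_perms p S \<and> v \<in> des_perms q S'"
proof -
  let ?z = "\<xi> \<circ> cross p u v"
  define P where "P = (\<lambda>k. k \<notin> insert p (S \<union> (+) p ` S') \<longrightarrow> ?z k < ?z (Suc k))"
  have z: "?z permutes {1..p + q}"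
    using \<xi> by (intro permutes_compose[OF cross_permutes[OF u v]]) (auto simp: grassmannian_def)
  have l: "P k \<longleftrightarrow> (k \<notin> S \<longrightarrow> u k < u (Suc k))" if "1 \<le> k" "k < p" for k
    using factor_less_iff(1)[OF \<xi> u v, of k "Suc k"] that by (auto simp: P_def)
  \<comment> \<open>The bound on \<open>S\<close> matters here: its elements stay below
    \<open>p\<close>, so \<open>p + k\<close> can be allowed only through \<open>S'\<close>.\<close>
  have "p + k \<in> insert p (S \<union> (+) p ` S') \<longleftrightarrow> k \<in> S'" if "1 \<le> k" for k
    using that S by auto
  then have r: "P (p + k) \<longleftrightarrow> (k \<notin> S' \<longrightarrow> v k < v (Suc k))" if "1 \<le> k" "k < q" for k
    using factor_less_iff(2)[OF \<xi> u v, of k "Suc k"] that by (simp add: P_def del: insert_iff Un_iff)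
  have "(\<forall>k. 1 \<le> k \<longrightarrow> k < p + q \<longrightarrow> P k) \<longleftrightarrow>
    (\<forall>k. 1 \<le> k \<longrightarrow> k < p \<longrightarrow> P k) \<and> (\<forall>k. 1 \<le> k \<longrightarrow> k < q \<longrightarrow> P (p + k))" (is "?A \<longleftrightarrow> ?B \<and> ?C")
  proof
    assume A: ?A
    then show "?B \<and> ?C" by simp
  next
    assume BC: "?B \<and> ?C"
    show ?A
    proof (intro allI impI)
      fix k assume k: "1 \<le> k" "k < p + q"
      consider "k < p" | "k = p" | "p < k" by linarith
      then show "P k"
      proof cases
        case 1
        with BC k show ?thesis by blast
      next
        case 2
        then show ?thesis by (simp add: P_def)
      next
        case 3
        with k BC[THEN conjunct2, rule_format, of "k - p"] show ?thesis by simp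
      qed
    qed
  qed
  moreover have "?z \<in> des_perms (p + q) (insert p (S \<union> (+) p ` S')) \<longleftrightarrow>
      (\<forall>k. 1 \<le> k \<longrightarrow> k < p + q \<longrightarrow> P k)"
    using z unfolding mem_des_perms_iff P_def by blast
  ultimately show ?thesis
    using l r u v by (simp add: mem_des_perms_iff)
qed

text \<open>The factorization \<open>\<zeta> = \<xi> (u \<times> v)\<close>, in which \<open>u\<close> and \<open>v\<close> are the standardizations of the first \<open>p\<close>
  and the last \<open>q\<close> letters of \<open>\<zeta>\<close> and \<open>\<xi>\<close> is a minimal coset representative, is unique.\<close>

lemma sum_factorization:
  assumes S: "S \<subseteq> {1..p - 1}"
  shows "(\<Sum>u\<in>des_perms p S. \<Sum>v\<in>des_perms q S'. \<Sum>\<xi>\<in>grassmannian p q. h (\<xi> \<circ> cross p u v)) =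
    (\<Sum>\<zeta>\<in>des_perms (p + q) (insert p (S \<union> (+) p ` S')). h \<zeta>)"
proof -
  let ?T = "insert p (S \<union> (+) p ` S')"
  let ?st = "\<lambda>z. cross p (st (subword z 0 p)) (st (subword z p (p + q)))"
  let ?i = "\<lambda>z. (st (subword z 0 p), st (subword z p (p + q)), z \<circ> inv (?st z))"
  have st: "st (subword z 0 p) permutes {1..p}" "st (subword z p (p + q)) permutes {1..q}"
    if "z permutes {1..p + q}" for z
    using st_subword(1)[OF permutes_inj[OF that], of 0 p]
      st_subword(1)[OF permutes_inj[OF that], of p "p + q"] by simp_all
  \<comment> \<open>Inside each block the inverse of the standardization lists the positions by
    increasing letter, so composing \<open>z\<close> with it sorts the letters of each
    block.\<close>
  have grass: "z \<circ> inv (?st z) \<in> grassmannian p q" if z: "z permutes {1..p + q}" for z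
    unfolding grassmannian_eq_des_perms mem_des_perms_iff
  proof (intro conjI allI impI)
    let ?u = "st (subword z 0 p)" and ?v = "st (subword z p (p + q))"
    show "z \<circ> inv (?st z) permutes {1..p + q}"
      by (rule permutes_compose[OF permutes_inv[OF cross_permutes[OF st[OF z]]] z])
    fix k assume k: "1 \<le> k" "k < p + q" "k \<notin> {p}"
    note u = permutes_inv[OF st(1)[OF z]] and v = permutes_inv[OF st(2)[OF z]]
    have inv_st: "inv (?st z) = cross p (inv ?u) (inv ?v)"
      by (rule inv_cross[OF st[OF z]])
    show "(z \<circ> inv (?st z)) k < (z \<circ> inv (?st z)) (Suc k)"
    proof (cases "k < p")
      case True
      have "inv ?u k \<in> {1..p}" "inv ?u (Suc k) \<in> {1..p}"
        by (simp_all only: permutes_in_image[OF u]) (use k True in auto)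
      then show ?thesis
        using st_subword(2)[OF permutes_inj[OF z], of "inv ?u k" p 0 "inv ?u (Suc k)"] True
          permutes_inverses(1)[OF st(1)[OF z]]
        by (simp add: inv_st cross_left)
    next
      case False
      define l where "l = k - p"
      have l: "k = p + l" "1 \<le> l" "l < q" using False k by (auto simp: l_def)
      have "inv ?v l \<in> {1..q}" "inv ?v (Suc l) \<in> {1..q}"
        by (simp_all only: permutes_in_image[OF v]) (use l in auto)
      then show ?thesis
        using st_subword(2)[OF permutes_inj[OF z], of "inv ?v l" "p + q" p "inv ?v (Suc l)"] l
          permutes_inverses(1)[OF st(2)[OF z]]
          cross_right[of l p "inv ?u" "inv ?v"] cross_right[of "Suc l" p "inv ?u" "inv ?v"]
        by (simp add: inv_st add.commute)
    qed
  qed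
  have z_eq: "(z \<circ> inv (?st z)) \<circ> ?st z = z" if z: "z permutes {1..p + q}" for z
    using permutes_inv_o(2)[OF cross_permutes[OF st[OF z]]] by (simp add: o_assoc[symmetric])
  have "(\<Sum>(u, v, \<xi>)\<in>des_perms p S \<times> des_perms q S' \<times> grassmannian p q. h (\<xi> \<circ> cross p u v)) =
    (\<Sum>\<zeta>\<in>des_perms (p + q) ?T. h \<zeta>)"
  proof (rule sum.reindex_bij_witness[where i = ?i and j = "\<lambda>(u, v, \<xi>). \<xi> \<circ> cross p u v"])
    fix a assume "a \<in> des_perms p S \<times> des_perms q S' \<times> grassmannian p q"
    then obtain u v \<xi> where a: "a = (u, v, \<xi>)"
      and mem: "u \<in> des_perms p S" "v \<in> des_perms q S'" "\<xi> \<in> grassmannian p q" by auto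
    then have u: "u permutes {1..p}" and v: "v permutes {1..q}"
      and \<xi>: "\<xi> permutes {1..p + q}"
      by (auto simp: des_perms_def grassmannian_def)
    define z where "z = \<xi> \<circ> cross p u v"
    have c: "cross p u v permutes {1..p + q}" by (rule cross_permutes[OF u v])
    have z: "z permutes {1..p + q}"
      unfolding z_def by (rule permutes_compose[OF c \<xi>])
    have "st (subword z 0 p) = u"
      by (rule st_subword_eqI[OF permutes_inj[OF z]])
        (use u factor_less_iff(1)[OF mem(3) u v] in \<open>auto simp: z_def\<close>)
    moreover have "st (subword z p (p + q)) = v"
      by (rule st_subword_eqI[OF permutes_inj[OF z]])
        (use v factor_less_iff(2)[OF mem(3) u v] in \<open>auto simp: z_def\<close>)
    moreover have "z \<circ> inv (cross p u v) = \<xi>"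
      using permutes_inv_o(1)[OF c] by (simp add: z_def o_assoc[symmetric])
    ultimately show "?i (case a of (u, v, \<xi>) \<Rightarrow> \<xi> \<circ> cross p u v) = a"
      by (simp add: a z_def)
    show "(case a of (u, v, \<xi>) \<Rightarrow> \<xi> \<circ> cross p u v) \<in> des_perms (p + q) ?T"
      using factor_mem_iff[OF S mem(3) u v] mem by (simp add: a)
  next
    fix z assume "z \<in> des_perms (p + q) ?T"
    then have z: "z permutes {1..p + q}" and "(z \<circ> inv (?st z)) \<circ> ?st z \<in> des_perms (p + q) ?T"
      using z_eq by (auto simp: des_perms_def)
    with factor_mem_iff[OF S grass[OF z] st[OF z]] grass[OF z]
    show "?i z \<in> des_perms p S \<times> des_perms q S' \<times> grassmannian p q" by simp
    show "(case ?i z of (u, v, \<xi>) \<Rightarrow> \<xi> \<circ> cross p u v) = z"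
      using z_eq[OF z] by simp
  qed auto
  then show ?thesis by (simp add: sum.cartesian_product)
qed


section \<open>Products of sums over descent classes\<close>

definition coarsened :: "nat \<Rightarrow> (nat \<Rightarrow> nat) \<Rightarrow> nat set \<Rightarrow> ssym" where
  "coarsened n u S = (\<Sum>\<zeta>\<in>des_perms n S. F n (u \<circ> inv \<zeta>))"

lemma coarsened_empty: "coarsened n u {} = F n u"
  by (simp add: coarsened_def des_perms_empty)

text \<open>Bilinear expansion gives a sum over \<open>a\<close>, \<open>b\<close> and
  \<open>\<xi>\<close>. As \<open>cross\<close> respects composition and inverses, each term has the
  permutation \<open>cross p u v \<circ> inv (\<xi> \<circ> cross p a b)\<close>, and by
  \<open>sum_factorization\<close> the inverted factor runs exactly once through the permutations
  with descents in the combined set.\<close>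

lemma ssym_prod_coarsened:
  assumes u: "u permutes {1..p}" and v: "v permutes {1..q}" and S: "S \<subseteq> {1..p - 1}"
  shows "coarsened p u S \<odot> coarsened q v S' =
    coarsened (p + q) (cross p u v) (insert p (S \<union> (+) p ` S'))"
proof -
  have "F p (u \<circ> inv a) \<odot> F q (v \<circ> inv b) =
      (\<Sum>\<xi>\<in>grassmannian p q. F (p + q) (cross p u v \<circ> inv (\<xi> \<circ> cross p a b)))"
    if "a \<in> des_perms p S" "b \<in> des_perms q S'" for a b
  proof -
    from that have a: "a permutes {1..p}" and b: "b permutes {1..q}"
      by (auto simp: des_perms_def)
    have "cross p (u \<circ> inv a) (v \<circ> inv b) \<circ> inv \<xi> = cross p u v \<circ> inv (\<xi> \<circ> cross p a b)"
      if "\<xi> \<in> grassmannian p q" for \<xi>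
    proof -
      have "\<xi> permutes {1..p + q}" using that by (simp add: grassmannian_def)
      then have "inv (\<xi> \<circ> cross p a b) = inv (cross p a b) \<circ> inv \<xi>"
        by (intro o_inv_distrib permutes_bij[OF cross_permutes[OF a b]] permutes_bij)
      then show ?thesis
        by (simp add: inv_cross[OF a b] o_assoc
            cross_comp[OF permutes_inv[OF a] permutes_inv[OF b]])
    qed
    then show ?thesis
      by (simp add: ssym_prod_F[OF permutes_compose[OF permutes_inv[OF a] u]
            permutes_compose[OF permutes_inv[OF b] v]])
  qed
  then have "(\<Sum>a\<in>des_perms p S. \<Sum>b\<in>des_perms q S'. F p (u \<circ> inv a) \<odot> F q (v \<circ> inv b)) =
      (\<Sum>a\<in>des_perms p S. \<Sum>b\<in>des_perms q S'. \<Sum>\<xi>\<in>grassmannian p q.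
        F (p + q) (cross p u v \<circ> inv (\<xi> \<circ> cross p a b)))"
    by (intro sum.cong refl) simp
  also have "\<dots> = coarsened (p + q) (cross p u v) (insert p (S \<union> (+) p ` S'))"
    unfolding coarsened_def by (rule sum_factorization[OF S])
  finally show ?thesis
    by (simp only: coarsened_def[of p] coarsened_def[of q] ssym_prod_sum_left ssym_prod_sum_right
        sum.swap[of _ "des_perms q S'"])
qed

section \<open>The unit of the product\<close>

lemma ssym_prod_F0_right: "u permutes {1..n} \<Longrightarrow> F n u \<odot> F 0 id = F n u"
proof -
  assume u: "u permutes {1..n}"
  have "F n u \<odot> F 0 id = coarsened n u {} \<odot> coarsened 0 id {}"
    by (simp only: coarsened_empty)
  also have "\<dots> = coarsened (n + 0) (cross n u id) (insert n ({} \<union> (+) n ` {}))"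
    by (rule ssym_prod_coarsened[OF u permutes_id]) simp
  also have "\<dots> = coarsened n u {n}"
    by (simp only: cross_id[OF u] image_empty Un_empty_left add_0_right)
  \<comment> \<open>The product formula adds a cut at \<open>n\<close>, which is not a descent
    position and so drops out.\<close>
  also have "\<dots> = coarsened n u ({n} \<inter> {1..n - 1})"
    unfolding coarsened_def by (subst des_perms_Int) (rule refl)
  also have "{n} \<inter> {1..n - 1} = {}" by auto
  finally show ?thesis by (simp only: coarsened_empty)
qed

lemma ssym_prod_F0_left: "u permutes {1..n} \<Longrightarrow> F 0 id \<odot> F n u = F n u"
proof -
  assume u: "u permutes {1..n}"
  have "cross 0 id u = u"
    using permutes_not_in[OF u, of 0] by (auto simp: cross_def fun_eq_iff)
  moreover have "F 0 id \<odot> F n u = coarsened 0 id {} \<odot> coarsened n u {}"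
    by (simp only: coarsened_empty)
  moreover have "\<dots> = coarsened (0 + n) (cross 0 id u) (insert 0 ({} \<union> (+) 0 ` {}))"
    by (rule ssym_prod_coarsened[OF permutes_id u]) simp
  ultimately have "F 0 id \<odot> F n u = coarsened n u {0}"
    by (simp only: image_empty Un_empty_left add_0_left)
  also have "\<dots> = coarsened n u ({0} \<inter> {1..n - 1})"
    unfolding coarsened_def by (subst des_perms_Int) (rule refl)
  also have "{0} \<inter> {1..n - 1} = {}" by auto
  finally show ?thesis by (simp only: coarsened_empty)
qed

lemma linear_id: "Vector_Spaces.linear scale scale id"
  by (simp add: linear_iff_scale)

lemma ssym_prod_unit_right: "x \<odot> F 0 id = x"
proof -
  have "(\<lambda>x. x \<odot> F 0 id) = id"
    by (rule linear_eq_on_F[OF ssym_prod_linear_left linear_id]) (simp only: ssym_prod_F0_right id_apply)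
  then show ?thesis by (metis id_apply)
qed

lemma ssym_prod_unit_left: "F 0 id \<odot> x = x"
proof -
  have "ssym_prod (F 0 id) = id"
    by (rule linear_eq_on_F[OF ssym_prod_linear_right linear_id]) (simp only: ssym_prod_F0_left id_apply)
  then show ?thesis by simp
qed


section \<open>Block standardization\<close>

text \<open>The fold in \<open>block_std\<close> with start \<open>a\<close>, end \<open>b\<close>
  and trailing factor \<open>w\<close> left free, to allow induction on the cuts \<open>xs\<close>
  and splitting at a cut.\<close>

definition cross_blocks ::
  "(nat \<Rightarrow> nat) \<Rightarrow> nat \<Rightarrow> nat list \<Rightarrow> nat \<Rightarrow> (nat \<Rightarrow> nat) \<Rightarrow> nat \<Rightarrow> nat" where
  "cross_blocks v a xs b w =
     foldr (\<lambda>(a, b) w. cross (b - a) (st (subword v a b)) w) (zip (a # xs) (xs @ [b])) w"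

lemma cross_blocks_Nil: "cross_blocks v a [] b w = cross (b - a) (st (subword v a b)) w"
  by (simp add: cross_blocks_def)

lemma cross_blocks_Cons:
  "cross_blocks v a (c # xs) b w = cross (c - a) (st (subword v a c)) (cross_blocks v c xs b w)"
  by (simp add: cross_blocks_def)

lemma cross_blocks_append:
  "cross_blocks v a (xs @ c # ys) b w = cross_blocks v a xs c (cross_blocks v c ys b w)"
  by (induction xs arbitrary: a) (simp_all add: cross_blocks_Nil cross_blocks_Cons)

text \<open>Associativity of \<open>cross\<close> moves the trailing factor out. Sortedness makes
  the truncated differences add up: \<open>(c - a) + (b - c) = b - a\<close>.\<close>

lemma cross_blocks_eq_cross:
  "sorted (a # xs @ [b]) \<Longrightarrow> cross_blocks v a xs b w = cross (b - a) (cross_blocks v a xs b id) w"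
proof (induction xs arbitrary: a)
  case Nil
  then show ?case by (auto simp: cross_blocks_Nil cross_def)
next
  case (Cons c xs)
  then have le: "a \<le> c" "c \<le> b" by auto
  have IH: "cross_blocks v c xs b w = cross (b - c) (cross_blocks v c xs b id) w"
    by (rule Cons.IH) (use Cons.prems in auto)
  have "c - a + (b - c) = b - a"
    using le by simp
  with cross_assoc[of "c - a" "b - c" _ "cross_blocks v c xs b id" w] show ?case
    by (simp only: cross_blocks_Cons IH)
qed

lemma cross_blocks_permutes:
  "inj v \<Longrightarrow> sorted (a # xs @ [b]) \<Longrightarrow> cross_blocks v a xs b id permutes {1..b - a}"
proof (induction xs arbitrary: a)
  case Nil
  then have "st (subword v a b) permutes {1..b - a}"
    by (intro st_subword(1))
  then show ?case
    by (simp only: cross_blocks_Nil cross_id)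
next
  case (Cons c xs)
  then have "a \<le> c" "c \<le> b" by auto
  then have "c - a + (b - c) = b - a" by simp
  with Cons show ?case
    using cross_permutes[OF st_subword(1)[of v a c] Cons.IH[of c]] by (simp add: cross_blocks_Cons)
qed

text \<open>Standardizing a window and then its blocks agrees with standardizing those blocks of
  \<open>v\<close> directly; cuts shift by the start of the window and block lengths do not
  change.\<close>

lemma cross_blocks_shift:
  assumes "inj v"
  shows "b \<le> q \<Longrightarrow> \<forall>x\<in>set xs. x \<le> q \<Longrightarrow>
    cross_blocks (st (subword v a (a + q))) c xs b w =
    cross_blocks v (a + c) (map ((+) a) xs) (a + b) w"
  by (induction xs arbitrary: c)
    (simp_all add: cross_blocks_Nil cross_blocks_Cons st_subword_st_subword[OF assms])

lemma block_std_eq: "block_std n v S = cross_blocks v 0 (sorted_list_of_set S) n id"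
  by (simp add: block_std_def cross_blocks_def Let_def)

lemma sorted_list_of_subset:
  assumes "S \<subseteq> {1..n - (1::nat)}"
  shows "sorted (0 # sorted_list_of_set S @ [n])" "set (sorted_list_of_set S) = S"
    "\<forall>x\<in>S. x \<le> n"
proof -
  have "finite S" by (rule finite_subset[OF assms]) simp
  then show "set (sorted_list_of_set S) = S" by simp
  moreover show "\<forall>x\<in>S. x \<le> n"
    using assms by fastforce
  ultimately show "sorted (0 # sorted_list_of_set S @ [n])"
    by (simp add: sorted_append)
qed

lemma block_std_permutes:
  assumes "inj v" "S \<subseteq> {1..n - 1}"
  shows "block_std n v S permutes {1..n}"
  using cross_blocks_permutes[OF assms(1) sorted_list_of_subset(1)[OF assms(2)]]
  by (simp add: block_std_eq)

lemma block_std_empty: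
  assumes "v permutes {1..n}"
  shows "block_std n v {} = v"
  using assms by (simp add: block_std_eq cross_blocks_Nil st_subword_whole cross_id)

text \<open>The sorted cuts are those of \<open>S\<close>, then \<open>p\<close>, then those of
  \<open>S'\<close> moved up by \<open>p\<close>. Splitting the fold at \<open>p\<close> gives two
  folds, one over the prefix and one over the suffix of \<open>v\<close>.\<close>

lemma block_std_split:
  assumes v: "inj v" and p: "1 \<le> p" "p < n"
    and S: "S \<subseteq> {1..p - 1}" and S': "S' \<subseteq> {1..n - p - 1}"
  shows "block_std n v (insert p (S \<union> (+) p ` S')) =
    cross p (block_std p (st (subword v 0 p)) S) (block_std (n - p) (st (subword v p n)) S')"
proof -
  let ?xs = "sorted_list_of_set S" and ?ys = "sorted_list_of_set S'"
  note S_list = sorted_list_of_subset[OF S] and S'_list = sorted_list_of_subset[OF S']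
  have fin: "finite S" "finite S'"
    using S S' by (auto intro: finite_subset)
  have "sorted_list_of_set (insert p (S \<union> (+) p ` S')) = ?xs @ p # map ((+) p) ?ys"
  proof (rule strict_sorted_equal)
    show "sorted_wrt (<) (?xs @ p # map ((+) p) ?ys)"
      using S S' S_list(2) S'_list(2) p by (fastforce simp: sorted_wrt_append sorted_wrt_map)
    show "sorted_wrt (<) (sorted_list_of_set (insert p (S \<union> (+) p ` S')))"
      by (rule strict_sorted_list_of_set)
    have "set (sorted_list_of_set (insert p (S \<union> (+) p ` S'))) = insert p (S \<union> (+) p ` S')"
      by (rule set_sorted_list_of_set) (use fin in simp)
    then show "set (sorted_list_of_set (insert p (S \<union> (+) p ` S'))) = set (?xs @ p # map ((+) p) ?ys)"
      by (simp only:) (use fin in auto)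
  qed
  then have "block_std n v (insert p (S \<union> (+) p ` S')) =
      cross_blocks v 0 ?xs p (cross_blocks v p (map ((+) p) ?ys) n id)"
    by (simp add: block_std_eq cross_blocks_append)
  also have "\<dots> = cross p (cross_blocks v 0 ?xs p id) (cross_blocks v p (map ((+) p) ?ys) n id)"
    by (subst cross_blocks_eq_cross[OF S_list(1)]) simp
  also have "cross_blocks v 0 ?xs p id = block_std p (st (subword v 0 p)) S"
    using cross_blocks_shift[OF v, of p p ?xs 0 0 id] S_list
    by (simp add: block_std_eq map_idI)
  also have "cross_blocks v p (map ((+) p) ?ys) n id = block_std (n - p) (st (subword v p n)) S'"
    using cross_blocks_shift[OF v, of "n - p" "n - p" ?ys p 0] S'_list p by (simp add: block_std_eq)
  finally show ?thesis .
qed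


section \<open>The antipode\<close>

lemma sum_Pow_by_Max:
  fixes h :: "nat set \<Rightarrow> 'a :: comm_monoid_add"
  shows "(\<Sum>S\<in>Pow {1..m}. h S) = h {} + (\<Sum>p = 1..m. \<Sum>S\<in>Pow {1..p - 1}. h (insert p S))"
proof (induction m)
  case (Suc m)
  have "Pow {1..Suc m} = Pow {1..m} \<union> insert (Suc m) ` Pow {1..m}"
    by (simp add: Pow_insert atLeastAtMostSuc_conv)
  moreover have "inj_on (insert (Suc m)) (Pow {1..m})"
    by (rule inj_onI) (metis PowD atLeastAtMost_iff insert_ident not_less_eq_eq order_refl subsetD)
  moreover have "Pow {1..m} \<inter> insert (Suc m) ` Pow {1..m} = {}" by auto
  ultimately have "(\<Sum>S\<in>Pow {1..Suc m}. h S) =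
      (\<Sum>S\<in>Pow {1..m}. h S) + (\<Sum>S\<in>Pow {1..m}. h (insert (Suc m) S))"
    by (simp add: sum.union_disjoint sum.reindex)
  with Suc show ?case by (simp add: add.assoc)
qed simp

text \<open>The elements above the minimum \<open>p\<close> are recorded after subtracting
  \<open>p\<close>, matching the cuts of a suffix. Induction peels off \<open>1\<close>: subsets
  avoiding it are shifts of subsets of \<open>{1..m}\<close>, so \<open>h\<close> has to stay
  arbitrary.\<close>

lemma sum_Pow_by_Min:
  fixes h :: "nat set \<Rightarrow> 'a :: comm_monoid_add"
  shows "(\<Sum>S\<in>Pow {1..m}. h S) =
    h {} + (\<Sum>p = 1..m. \<Sum>S\<in>Pow {1..m - p}. h (insert p ((+) p ` S)))"
proof (induction m arbitrary: h)
  case (Suc m)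
  let ?s = "(`) ((+) (1::nat))"
  have img: "(+) 1 ` {1..m} = {2..Suc m}"
    using image_add_atLeastAtMost[of 1 1 m] by (simp add: numeral_2_eq_2)
  have "{1..Suc m} = insert 1 ((+) 1 ` {1..m})" unfolding img by auto
  then have Pow: "Pow {1..Suc m} = ?s ` Pow {1..m} \<union> (\<lambda>S. insert 1 (?s S)) ` Pow {1..m}"
    by (simp only: Pow_insert image_Pow_surj[OF refl, symmetric] image_image)
  have inj_s: "inj ?s" by (rule injI) (simp add: inj_image_eq_iff)
  have "inj_on (\<lambda>S. insert 1 (?s S)) (Pow {1..m})"
  proof (rule inj_onI)
    fix A B assume "A \<in> Pow {1..m}" "B \<in> Pow {1..m}" "insert 1 (?s A) = insert 1 (?s B)"
    moreover from this have "1 \<notin> ?s A" "1 \<notin> ?s B" by auto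
    ultimately have "?s A = ?s B" by (metis insert_ident)
    then show "A = B" by (rule injD[OF inj_s])
  qed
  moreover have "inj_on ?s (Pow {1..m})"
    by (rule inj_on_subset[OF inj_s]) simp
  moreover have "?s ` Pow {1..m} \<inter> (\<lambda>S. insert 1 (?s S)) ` Pow {1..m} = {}"
  proof (rule equals0I)
    fix X assume X: "X \<in> ?s ` Pow {1..m} \<inter> (\<lambda>S. insert 1 (?s S)) ` Pow {1..m}"
    then have "1 \<in> X" by (elim IntE imageE) simp
    moreover from X obtain A where "A \<subseteq> {1..m}" "X = ?s A"
      by (elim IntE imageE[of _ ?s]) simp
    ultimately show False by auto
  qed
  ultimately have "(\<Sum>S\<in>Pow {1..Suc m}. h S) =
      (\<Sum>S\<in>Pow {1..m}. h (?s S)) + (\<Sum>S\<in>Pow {1..m}. h (insert 1 (?s S)))"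
    unfolding Pow by (subst sum.union_disjoint) (simp_all only: sum.reindex o_def finite_imageI
        finite_Pow_iff finite_atLeastAtMost)
  \<comment> \<open>Induction hypothesis for \<open>h\<close> composed with the shift: the minimum
    \<open>p\<close> becomes \<open>Suc p\<close>, and \<open>m - p\<close> is
    \<open>Suc m - Suc p\<close>.\<close>
  also have "(\<Sum>S\<in>Pow {1..m}. h (?s S)) =
      h {} + (\<Sum>p = 1..m. \<Sum>S\<in>Pow {1..m - p}. h (insert (Suc p) ((+) (Suc p) ` S)))"
    using Suc[of "\<lambda>S. h (?s S)"] by (simp add: image_image)
  also have "(\<Sum>p = 1..m. \<Sum>S\<in>Pow {1..m - p}. h (insert (Suc p) ((+) (Suc p) ` S))) =
      (\<Sum>p = Suc 1..Suc m. \<Sum>S\<in>Pow {1..Suc m - p}. h (insert p ((+) p ` S)))"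
    by (subst sum.shift_bounds_cl_Suc_ivl) simp
  finally show ?case
    by (subst sum.atLeast_Suc_atMost) (simp_all add: ac_simps)
qed simp

text \<open>Degree 0 is separate: there \<open>n - 1\<close> is \<open>0\<close>, and the sum would
  be the single term \<open>S = {}\<close> with sign \<open>-1\<close>, giving
  \<open>- F 0 id\<close> instead of the unit.\<close>

definition antipode_F :: "nat \<Rightarrow> (nat \<Rightarrow> nat) \<Rightarrow> ssym" where
  "antipode_F n v = (if n = 0 then F 0 id else
     \<Sum>S\<in>Pow {1..n - 1}. scale ((-1) ^ (card S + 1)) (coarsened n (block_std n v S) S))"

definition antipode_map :: "ssym \<Rightarrow> ssym" where
  "antipode_map = lin_ext (\<lambda>a. case Rep_graded_perm a of (n, v) \<Rightarrow> antipode_F n v)"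

lemma antipode_map_F: "v permutes {1..n} \<Longrightarrow> antipode_map (F n v) = antipode_F n v"
  by (simp add: antipode_map_def F_def lin_ext_single Rep_Abs_graded_perm)

lemma antipode_map_linear: "Vector_Spaces.linear scale scale antipode_map"
  unfolding antipode_map_def by (rule lin_ext_linear)

lemma sum_split_ends:
  fixes g :: "nat \<Rightarrow> 'a :: comm_monoid_add"
  assumes "1 \<le> n"
  shows "(\<Sum>p = 0..n. g p) = g 0 + (\<Sum>p = 1..n - 1. g p) + g n"
proof -
  obtain m where n: "n = Suc m" using assms by (cases n) auto
  show ?thesis by (simp add: n sum.atLeast0_atMost_Suc_shift) (simp add: sum.atLeast_Suc_atMost)
qed

section \<open>Cancellation in both convolutions, for a fixed permutation of positive degree\<close>

context
  fixes n :: nat and v :: "nat \<Rightarrow> nat" and h :: "nat set \<Rightarrow> ssym"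
  assumes n: "1 \<le> n" and v: "v permutes {1..n}"
  defines "h \<equiv> \<lambda>S. scale ((-1) ^ (card S + 1)) (coarsened n (block_std n v S) S)"
begin

lemma h_empty: "h {} = - F n v"
  by (simp add: h_def coarsened_empty block_std_empty[OF v] scale_minus_left scale_one)

lemma antipode_F_eq: "antipode_F n v = (\<Sum>S\<in>Pow {1..n - 1}. h S)"
  using n by (simp add: antipode_F_def h_def)

lemma st_prefix: "st (subword v 0 p) permutes {1..p}"
  using st_subword(1)[OF permutes_inj[OF v], of 0 p] by simp

lemma st_suffix: "st (subword v p n) permutes {1..n - p}"
  by (rule st_subword(1)[OF permutes_inj[OF v]])

lemma st_degree_0: "st (subword v p p) = id"
  using st_subword(1)[OF permutes_inj[OF v], of p p] by simp

text \<open>The product formula with empty \<open>S'\<close> adds the cut \<open>p\<close> to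
  \<open>S\<close>, \<open>block_std_split\<close> recognizes the block product as a block
  standardization of \<open>v\<close>, and the additional cut flips the sign.\<close>

lemma antipode_left_term:
  assumes p: "1 \<le> p" "p < n"
  shows "antipode_F p (st (subword v 0 p)) \<odot> F (n - p) (st (subword v p n)) =
    - (\<Sum>S\<in>Pow {1..p - 1}. h (insert p S))"
proof -
  let ?u = "st (subword v 0 p)" and ?w = "st (subword v p n)"
  have "scale ((-1) ^ (card S + 1)) (coarsened p (block_std p ?u S) S) \<odot> F (n - p) ?w =
      - h (insert p S)" if S: "S \<subseteq> {1..p - 1}" for S
  proof -
    have "coarsened p (block_std p ?u S) S \<odot> F (n - p) ?w =
        coarsened n (block_std n v (insert p S)) (insert p S)"
      using ssym_prod_coarsened[OF block_std_permutes[OF permutes_inj[OF st_prefix] S] st_suffix S,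
          where S' = "{}"]
        block_std_split[OF permutes_inj[OF v] p S, of "{}"] p
      by (simp add: coarsened_empty block_std_empty[OF st_suffix])
    moreover have "card (insert p S) = card S + 1"
      using S p by (subst card_insert_disjoint) (auto intro: finite_subset)
    then have "(-1) ^ (card (insert p S) + 1) = - ((-1) ^ (card S + 1) :: rat)"
      by simp
    ultimately show ?thesis
      by (simp only: ssym_prod_scale_left h_def scale_minus_left minus_minus)
  qed
  then show ?thesis
    using p by (simp add: antipode_F_def ssym_prod_sum_left sum_negf)
qed

text \<open>Mirror image of \<open>antipode_left_term\<close>: the cuts come from the suffix, hence
  appear shifted by \<open>p\<close>, above the smallest cut \<open>p\<close>.\<close>

lemma antipode_right_term:
  assumes p: "1 \<le> p" "p < n"
  shows "F p (st (subword v 0 p)) \<odot> antipode_F (n - p) (st (subword v p n)) =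
    - (\<Sum>S\<in>Pow {1..n - 1 - p}. h (insert p ((+) p ` S)))"
proof -
  let ?u = "st (subword v 0 p)" and ?w = "st (subword v p n)"
  have "F p ?u \<odot> scale ((-1) ^ (card S + 1)) (coarsened (n - p) (block_std (n - p) ?w S) S) =
      - h (insert p ((+) p ` S))" if S: "S \<subseteq> {1..n - p - 1}" for S
  proof -
    have "F p ?u \<odot> coarsened (n - p) (block_std (n - p) ?w S) S =
        coarsened n (block_std n v (insert p ((+) p ` S))) (insert p ((+) p ` S))"
      using ssym_prod_coarsened[OF st_prefix block_std_permutes[OF permutes_inj[OF st_suffix] S],
          where S = "{}" and S' = S]
        block_std_split[OF permutes_inj[OF v] p _ S, of "{}"] p
      by (simp add: coarsened_empty block_std_empty[OF st_prefix])
    moreover have "card (insert p ((+) p ` S)) = card S + 1"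
      using S by (subst card_insert_disjoint) (auto intro: finite_subset simp: card_image)
    then have "(-1) ^ (card (insert p ((+) p ` S)) + 1) = - ((-1) ^ (card S + 1) :: rat)"
      by simp
    ultimately show ?thesis
      by (simp only: ssym_prod_scale_right h_def scale_minus_left minus_minus)
  qed
  moreover have "n - p - 1 = n - 1 - p" by simp
  ultimately show ?thesis
    using p by (simp add: antipode_F_def ssym_prod_sum_right sum_negf)
qed

lemma convolution_antipode_left: "convolution antipode_map id (F n v) = 0"
proof -
  have "convolution antipode_map id (F n v) =
      (\<Sum>p = 0..n. antipode_F p (st (subword v 0 p)) \<odot> F (n - p) (st (subword v p n)))"
    by (simp add: convolution_F[OF v] antipode_map_F[OF st_prefix])
  \<comment> \<open>The cut at \<open>0\<close> contributes \<open>F n v\<close> through the unit,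
    the cut at \<open>n\<close> all of \<open>antipode_F n v\<close>.\<close>
  also have "\<dots> = F n v + (\<Sum>p = 1..n - 1. - (\<Sum>S\<in>Pow {1..p - 1}. h (insert p S))) + antipode_F n v"
  proof -
    have "antipode_F 0 (st (subword v 0 0)) \<odot> F (n - 0) (st (subword v 0 n)) = F n v"
      by (simp add: antipode_F_def st_subword_whole[OF v] ssym_prod_unit_left)
    moreover have "antipode_F n (st (subword v 0 n)) \<odot> F (n - n) (st (subword v n n)) = antipode_F n v"
      by (simp add: st_degree_0 st_subword_whole[OF v] ssym_prod_unit_right)
    moreover have "(\<Sum>p = 1..n - 1. antipode_F p (st (subword v 0 p)) \<odot> F (n - p) (st (subword v p n))) =
        (\<Sum>p = 1..n - 1. - (\<Sum>S\<in>Pow {1..p - 1}. h (insert p S)))"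
      by (rule sum.cong[OF refl]) (rule antipode_left_term, auto)
    ultimately show ?thesis by (simp only: sum_split_ends[OF n])
  qed
  \<comment> \<open>Grouped by maximum, \<open>antipode_F n v\<close> is \<open>h {}\<close> plus
    the negative of the middle sum, and \<open>h {}\<close> is \<open>- F n v\<close>.\<close>
  also have "\<dots> = 0"
    unfolding antipode_F_eq sum_Pow_by_Max[of h "n - 1"] sum_negf by (simp add: h_empty)
  finally show ?thesis .
qed

lemma convolution_antipode_right: "convolution id antipode_map (F n v) = 0"
proof -
  have "convolution id antipode_map (F n v) =
      (\<Sum>p = 0..n. F p (st (subword v 0 p)) \<odot> antipode_F (n - p) (st (subword v p n)))"
    by (simp add: convolution_F[OF v] antipode_map_F[OF st_suffix])
  also have "\<dots> = antipode_F n v +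
      (\<Sum>p = 1..n - 1. - (\<Sum>S\<in>Pow {1..n - 1 - p}. h (insert p ((+) p ` S)))) + F n v"
  proof -
    have "F 0 (st (subword v 0 0)) \<odot> antipode_F (n - 0) (st (subword v 0 n)) = antipode_F n v"
      by (simp add: st_degree_0 st_subword_whole[OF v] ssym_prod_unit_left)
    moreover have "F n (st (subword v 0 n)) \<odot> antipode_F (n - n) (st (subword v n n)) = F n v"
      by (simp add: antipode_F_def st_subword_whole[OF v] ssym_prod_unit_right)
    moreover have "(\<Sum>p = 1..n - 1. F p (st (subword v 0 p)) \<odot> antipode_F (n - p) (st (subword v p n))) =
        (\<Sum>p = 1..n - 1. - (\<Sum>S\<in>Pow {1..n - 1 - p}. h (insert p ((+) p ` S))))"
      by (rule sum.cong[OF refl]) (rule antipode_right_term, auto)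
    ultimately show ?thesis by (simp only: sum_split_ends[OF n])
  qed
  \<comment> \<open>The same cancellation, grouped by minimum.\<close>
  also have "\<dots> = 0"
    unfolding antipode_F_eq sum_Pow_by_Min[of h "n - 1"] sum_negf by (simp add: h_empty)
  finally show ?thesis .
qed

end

section \<open>Existence and uniqueness of the antipode\<close>

lemma convolution_F0:
  "convolution f g (F 0 id) = f (F 0 id) \<odot> g (F 0 id)"
proof -
  have "st (subword id 0 0) = id"
    using st_subword_whole[of id 0] by (simp add: permutes_id)
  then show ?thesis by (simp add: convolution_F permutes_id)
qed

lemma is_antipode_antipode_map: "is_antipode antipode_map"
  unfolding is_antipode_def
proof (intro conjI linear_eq_on_F convolution_linear unit_counit_linear antipode_map_linear)
  fix n :: nat and u :: "nat \<Rightarrow> nat" assume u: "u permutes {1..n}"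
  \<comment> \<open>The counit does not vanish in degree 0, so this degree is checked through the
    unit; positive degrees come from the cancellation.\<close>
  have "antipode_map (F 0 id) = F 0 id"
    by (simp add: antipode_map_F permutes_id antipode_F_def)
  then have "n = 0 \<Longrightarrow> convolution antipode_map id (F n u) = F 0 id"
    "n = 0 \<Longrightarrow> convolution id antipode_map (F n u) = F 0 id"
    using u by (simp_all add: convolution_F0 ssym_prod_unit_left)
  with convolution_antipode_left[OF _ u] convolution_antipode_right[OF _ u]
  show "convolution antipode_map id (F n u) = (ssym_unit \<circ> ssym_counit) (F n u)"
    "convolution id antipode_map (F n u) = (ssym_unit \<circ> ssym_counit) (F n u)"
    unfolding unit_counit_F[OF u] by (cases "n = 0"; simp)+
qed

text \<open>In degree \<open>n\<close> the top term of the convolution with \<open>id\<close> is \<open>f (F n u)\<close> itself, and the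
  others only involve the values of \<open>f\<close> in smaller degrees.\<close>

lemma convolution_left_inverse_unique:
  assumes f: "Vector_Spaces.linear scale scale f" and g: "Vector_Spaces.linear scale scale g"
    and eq: "convolution f id = convolution g id"
  shows "f = g"
proof (rule linear_eq_on_F[OF f g])
  fix n :: nat and u :: "nat \<Rightarrow> nat"
  assume "u permutes {1..n}"
  then show "f (F n u) = g (F n u)"
  proof (induction n arbitrary: u rule: less_induct)
    case (less n)
    note u = less.prems
    let ?t = "\<lambda>f p. f (F p (st (subword u 0 p))) \<odot> F (n - p) (st (subword u p n))"
    have top: "convolution f id (F n u) = (\<Sum>p<n. ?t f p) + f (F n u)" for f :: "ssym \<Rightarrow> ssym"
    proof -
      have "st (subword u n n) = id"
        using st_subword(1)[OF permutes_inj[OF u], of n n] by simp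
      moreover have "{0..n} = insert n {..<n}" by auto
      ultimately show ?thesis
        by (simp add: convolution_F[OF u] st_subword_whole[OF u] ssym_prod_unit_right add.commute)
    qed
    have "f (F p (st (subword u 0 p))) = g (F p (st (subword u 0 p)))" if "p < n" for p
      using less.IH[OF that] st_subword(1)[OF permutes_inj[OF u], of 0 p] by simp
    then have "(\<Sum>p<n. ?t f p) = (\<Sum>p<n. ?t g p)" by simp
    then show ?case
      using top[of f] top[of g] eq by simp
  qed
qed

lemma antipode_eq: "antipode = antipode_map"
  unfolding antipode_def
proof (rule the_equality)
  show "is_antipode antipode_map" by (rule is_antipode_antipode_map)
  fix S assume "is_antipode S"
  with is_antipode_antipode_map
  have "Vector_Spaces.linear scale scale S" "convolution S id = convolution antipode_map id"
    by (simp_all only: is_antipode_def)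
  then show "S = antipode_map"
    by (rule convolution_left_inverse_unique[OF _ antipode_map_linear])
qed

section \<open>Reading off the coefficients\<close>

lemma coarsened_by_word:
  assumes u: "u permutes {1..n}"
  shows "coarsened n u S = (\<Sum>w | w permutes {1..n}.
    scale (if Des n (inv w \<circ> u) \<subseteq> S then 1 else 0) (F n w))"
proof -
  have "coarsened n u S = (\<Sum>w\<in>{w. w permutes {1..n} \<and> Des n (inv w \<circ> u) \<subseteq> S}. F n w)"
    unfolding coarsened_def
  \<comment> \<open>Substituting \<open>w = u \<circ> inv \<zeta>\<close>, that is
    \<open>\<zeta> = inv w \<circ> u\<close>, turns the descent condition on \<open>\<zeta>\<close>
    into the one that occurs in \<open>lam\<close>.\<close>
  proof (rule sum.reindex_bij_witness[where i = "\<lambda>w. inv w \<circ> u" and j = "\<lambda>z. u \<circ> inv z"])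
    fix z assume "z \<in> des_perms n S"
    then have z: "z permutes {1..n}" and D: "Des n z \<subseteq> S" by (auto simp: des_perms_def)
    have "inv (u \<circ> inv z) = z \<circ> inv u"
      using permutes_bij[OF u] permutes_bij[OF permutes_inv[OF z]] permutes_inv_inv[OF z]
      by (simp add: o_inv_distrib)
    then show *: "inv (u \<circ> inv z) \<circ> u = z"
      using permutes_inv_o(2)[OF u] by (simp add: o_assoc[symmetric])
    show "u \<circ> inv z \<in> {w. w permutes {1..n} \<and> Des n (inv w \<circ> u) \<subseteq> S}"
      using D permutes_compose[OF permutes_inv[OF z] u] by (simp add: *)
  next
    fix w assume "w \<in> {w. w permutes {1..n} \<and> Des n (inv w \<circ> u) \<subseteq> S}"
    then have w: "w permutes {1..n}" and D: "Des n (inv w \<circ> u) \<subseteq> S" by auto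
    have "inv (inv w \<circ> u) = inv u \<circ> w"
      using permutes_bij[OF u] permutes_bij[OF permutes_inv[OF w]] permutes_inv_inv[OF w]
      by (simp add: o_inv_distrib)
    then show "u \<circ> inv (inv w \<circ> u) = w"
      using permutes_inv_o(1)[OF u] by (simp add: o_assoc)
    show "inv w \<circ> u \<in> des_perms n S"
      using D permutes_compose[OF u permutes_inv[OF w]] by (simp add: des_perms_def)
  qed auto
  also have "\<dots> = (\<Sum>w | w permutes {1..n}.
      scale (if Des n (inv w \<circ> u) \<subseteq> S then 1 else 0) (F n w))"
    by (rule sum.mono_neutral_cong_left)
      (auto simp: finite_permutations scale_one scale_zero)
  finally show ?thesis .
qed

text \<open>The sign with exponent \<open>card S + 1\<close> is \<open>1\<close> for odd and
  \<open>-1\<close> for even cardinality, so the signed count is the difference of the two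
  counts.\<close>

lemma lam_eq_sum:
  "of_int (lam n v w) = (\<Sum>S\<in>Pow {1..n - 1}. (-1) ^ (card S + 1) *
     (if Des n (inv w \<circ> block_std n v S) \<subseteq> S then 1 else 0) :: rat)"
proof -
  define A where "A = {S. S \<subseteq> {1..n - 1} \<and> Des n (inv w \<circ> block_std n v S) \<subseteq> S}"
  have A: "A \<subseteq> Pow {1..n - 1}" by (auto simp: A_def)
  then have fin: "finite A" by (rule finite_subset) simp
  have "(\<Sum>S\<in>Pow {1..n - 1}. (-1) ^ (card S + 1) *
      (if Des n (inv w \<circ> block_std n v S) \<subseteq> S then 1 else 0) :: rat) =
      (\<Sum>S\<in>A. if odd (card S) then 1 else - 1)"
    by (rule sum.mono_neutral_cong_right) (auto simp: A_def)
  also have "\<dots> = of_nat (card {S\<in>A. odd (card S)}) - of_nat (card {S\<in>A. even (card S)})"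
    using fin by (simp add: sum.If_cases Int_def)
  also have "\<dots> = of_int (lam n v w)"
    by (simp add: lam_def A_def conj_ac)
  finally show ?thesis by simp
qed

theorem theorem2p3:
  fixes n :: nat and v :: "nat \<Rightarrow> nat"
  assumes "n \<ge> 1" and "v permutes {1..n}"
  shows "antipode (F n v) = (\<Sum>w | w permutes {1..n}. scale (of_int (lam n v w)) (F n w))"
proof -
  have "antipode (F n v) =
      (\<Sum>S\<in>Pow {1..n - 1}. scale ((-1) ^ (card S + 1)) (coarsened n (block_std n v S) S))"
    using assms by (simp add: antipode_eq antipode_map_F antipode_F_def)
  \<comment> \<open>Each summand is spread over all \<open>w\<close> by an indicator, so that
    exchanging the sums collects the coefficient of \<open>F n w\<close>.\<close>
  also have "\<dots> = (\<Sum>S\<in>Pow {1..n - 1}. \<Sum>w | w permutes {1..n}.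
      scale ((-1) ^ (card S + 1) * (if Des n (inv w \<circ> block_std n v S) \<subseteq> S then 1 else 0)) (F n w))"
  proof (rule sum.cong[OF refl])
    fix S assume "S \<in> Pow {1..n - 1}"
    then have "block_std n v S permutes {1..n}"
      by (intro block_std_permutes permutes_inj[OF assms(2)]) simp
    then show "scale ((-1) ^ (card S + 1)) (coarsened n (block_std n v S) S) =
        (\<Sum>w | w permutes {1..n}. scale ((-1) ^ (card S + 1) *
          (if Des n (inv w \<circ> block_std n v S) \<subseteq> S then 1 else 0)) (F n w))"
      by (simp only: coarsened_by_word scale_sum_right
          vector_space.vector_space_assms(3)[OF vector_space_scale])
  qed
  also have "\<dots> = (\<Sum>w | w permutes {1..n}. scale (of_int (lam n v w)) (F n w))"
    unfolding lam_eq_sum scale_sum_left by (rule sum.swap)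
  finally show ?thesis .
qed

end
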